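(* Suppose the volume quadrature rule is exact for polynomials of degree at least $2p-1$ on $[-1,1]$, and let $\hat{\boldsymbol u}_m(t)$ satisfy, on each element $m$, the ESFR strong split form for Burgers' equation $$\frac{d}{dt}\hat{\boldsymbol u}_m^T=-\alpha(\boldsymbol M_m+\boldsymbol K_m)^{-1}\boldsymbol S_\xi\hat{\boldsymbol f}_m^{T}-(1-\alpha)(\boldsymbol M_m+\boldsymbol K_m)^{-1}\boldsymbol\chi(\boldsymbol\xi_v)^T\boldsymbol U\boldsymbol W\frac{\partial\boldsymbol\chi(\boldsymbol\xi_v)}{\partial\xi}\hat{\boldsymbol u}_m^T-(\boldsymbol M_m+\boldsymbol K_m)^{-1}\sum_{f\in\{L,R\}}\boldsymbol\chi(\xi_f)^T\,\hat n_f\Big(f^{*}_{m,f}-\alpha\,\boldsymbol\chi(\xi_f)\hat{\boldsymbol f}_m^{T}-(1-\alpha)f_{f}\Big)$$ with $\alpha=\tfrac23$. Then: (i) On each element, $$\frac12\frac{d}{dt}\|\boldsymbol u\|^2_{M_m+K_m}=-\hat{\boldsymbol u}_m\sum_{f\in\{L,R\}}\boldsymbol\chi(\xi_f)^T\,\hat n_f\Big(f^{*}_{m,f}-\tfrac13 f_f\Big).$$ (ii) Consider an interface between two adjacent elements, let $v_p$ and $w_0$ be the values at the interface of the discrete solution from the left and from the right element respectively, and let the numerical flux used by both elements at the interface be $$f^{*}=\frac12\Big(\frac{w_0^2}{2}+\frac{v_p^2}{2}\Big)-\lambda(w_0-v_p),\qquad\lambda\in\mathbb R.$$ Then the sum of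 the two face terms at this interface (one from each adjacent element) on the right-hand side of (i) equals $$(w_0-v_p)^2\Big(\tfrac1{12}(w_0-v_p)-\lambda\Big).$$ Consequently the interface contribution to the energy rate is nonpositive (the scheme is energy stable) whenever $\lambda\ge\frac1{12}(w_0-v_p)$. In particular this holds for the local Lax–Friedrichs choice $\lambda=\frac12\max(|w_0|,|v_p|)$, which satisfies $\frac12\max(|w_0|,|v_p|)\ge\frac1{12}(w_0-v_p)$.
   Context: Setting: the one-dimensional Burgers' equation $\partial_t u+\partial_x(u^2/2)=0$, discretized on elements, each mapped affinely from the reference element $[-1,1]$ (coordinate $\xi$) with constant Jacobian determinant $J_m>0$. Vectors of coefficients and nodal values are row vectors. Let $p\ge 1$ and let $\boldsymbol\chi(\xi)=[\chi_1(\xi),\dots,\chi_{p+1}(\xi)]$ be a (modal or nodal) basis of the polynomials of degree at most $p$ on $[-1,1]$. The discrete solution on element $m$ is $u_m(\xi,t)=\boldsymbol\chi(\xi)\hat{\boldsymbol u}_m(t)^T$. The volume quadrature has nodes $\boldsymbol\xi_v=(\xi_{v,1},\dots,\xi_{v,N_{vp}})$ in $[-1,1]$ and $\boldsymbol W$ is the diagonal matrix of its weights. $\boldsymbol\chi(\boldsymbol\xi_v)$ is the $N_{vp}\times(p+1)$ matrix with entries $\chi_j(\xi_{v,i})$, and $\partial\boldsymbol\chi(\boldsymbol\xi_v)/\partial\xi$ is the matrix with entries $\chi_j'(\xi_{v,i})$. The volume nodes need not coincide with interpolation nodes of the basis nor contain the endpoints. The faces are $L,R$ with $\xi_L=-1$,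 $\xi_R=1$, outward normals $\hat n_L=-1$, $\hat n_R=1$ (face quadrature weight $1$). Operators: $\boldsymbol M=\boldsymbol\chi(\boldsymbol\xi_v)^T\boldsymbol W\boldsymbol\chi(\boldsymbol\xi_v)$, $\boldsymbol M_m=J_m\boldsymbol M$, $\boldsymbol S_\xi=\boldsymbol\chi(\boldsymbol\xi_v)^T\boldsymbol W\,\partial\boldsymbol\chi(\boldsymbol\xi_v)/\partial\xi$, $\boldsymbol D^p=(\boldsymbol M^{-1}\boldsymbol S_\xi)^p$, and the ESFR correction operator $\boldsymbol K_m=c\,(\boldsymbol D^p)^T\boldsymbol M_m\boldsymbol D^p$, where $c$ is a real correction parameter. The matrices $\boldsymbol M$ and $\boldsymbol M_m+\boldsymbol K_m$ are invertible. The discrete $L_2$ projection is $\boldsymbol\Pi_m^p=\boldsymbol M_m^{-1}\boldsymbol\chi(\boldsymbol\xi_v)^T\boldsymbol W J_m$. Fluxes: $\boldsymbol u_m^T=\boldsymbol\chi(\boldsymbol\xi_v)\hat{\boldsymbol u}_m^T$ is the vector of solution values at volume nodes and $\boldsymbol U=\mathrm{diag}(\boldsymbol u_m)$. The modal flux coefficients are $\hat{\boldsymbol f}_m^T=\boldsymbol\Pi_m^p\big(\tfrac12\boldsymbol U\boldsymbol u_m^T\big)$. The face flux is $f_f=\tfrac12\big(\boldsymbol\chi(\xi_f)\hat{\boldsymbol u}_m^T\big)^2$. $f^{*}_{m,f}\in\mathbb R$ is the value of the numerical flux at face $f$ (arbitrary in part (i)). Discrete broken Sobolev norm: $\|\boldsymbol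 u\|^2_{M_m+K_m}=\hat{\boldsymbol u}_m(\boldsymbol M_m+\boldsymbol K_m)\hat{\boldsymbol u}_m^T$, so that $\frac12\frac{d}{dt}\|\boldsymbol u\|^2_{M_m+K_m}=\hat{\boldsymbol u}_m(\boldsymbol M_m+\boldsymbol K_m)\frac{d}{dt}\hat{\boldsymbol u}_m^T$. *)

theory Defs
  imports "HOL-Analysis.Analysis" "HOL-Computational_Algebra.Polynomial"
begin

text \<open>
  The index type \<open>'n\<close> labels the \<open>p + 1\<close> basis functions, \<open>'q\<close> the volume quadrature nodes, and
  \<open>'e\<close> the elements.  A coefficient row vector and its transpose are the same \<open>real ^ 'n\<close>;
  a product row times column is written with the inner product.
\<close>

datatype face = L | R

fun face_pt :: "face \<Rightarrow> real" where
  "face_pt L = -1"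
| "face_pt R = 1"

fun normal :: "face \<Rightarrow> real" where
  "normal L = -1"
| "normal R = 1"

text \<open>Uniqueness of the expansion gives linear independence; existence gives spanning.\<close>

definition poly_basis :: "nat \<Rightarrow> ('n::finite \<Rightarrow> real poly) \<Rightarrow> bool" where
  "poly_basis p B \<longleftrightarrow>
     (\<forall>j. degree (B j) \<le> p) \<and>
     (\<forall>r. degree r \<le> p \<longrightarrow> (\<exists>!a :: real ^ 'n. r = (\<Sum>j\<in>UNIV. smult (a $ j) (B j))))"

definition quadrature_exact :: "nat \<Rightarrow> real ^ 'q \<Rightarrow> real ^ 'q \<Rightarrow> bool" where
  "quadrature_exact d xi w \<longleftrightarrow>
     (\<forall>r :: real poly. degree r \<le> d \<longrightarrow>
        (\<Sum>i\<in>UNIV. w $ i * poly r (xi $ i)) = integral {-1..1} (poly r))"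

definition diag :: "real ^ 'q \<Rightarrow> real ^ 'q ^ 'q" where
  "diag v = (\<chi> i j. if i = j then v $ i else 0)"

definition matpow :: "real ^ 'n ^ 'n \<Rightarrow> nat \<Rightarrow> real ^ 'n ^ 'n" where
  "matpow A k = (((**) A) ^^ k) (mat 1)"

definition basis_at :: "('n \<Rightarrow> real poly) \<Rightarrow> real \<Rightarrow> real ^ 'n" where
  "basis_at B x = (\<chi> j. poly (B j) x)"

definition basis_mat :: "('n \<Rightarrow> real poly) \<Rightarrow> real ^ 'q \<Rightarrow> real ^ 'n ^ 'q" where
  "basis_mat B xi = (\<chi> i j. poly (B j) (xi $ i))"

definition dbasis_mat :: "('n \<Rightarrow> real poly) \<Rightarrow> real ^ 'q \<Rightarrow> real ^ 'n ^ 'q" where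
  "dbasis_mat B xi = (\<chi> i j. poly (pderiv (B j)) (xi $ i))"

definition mass :: "('n \<Rightarrow> real poly) \<Rightarrow> real ^ 'q \<Rightarrow> real ^ 'q \<Rightarrow> real ^ 'n ^ 'n" where
  "mass B xi w = transpose (basis_mat B xi) ** diag w ** basis_mat B xi"

definition elem_mass ::
    "('n \<Rightarrow> real poly) \<Rightarrow> real ^ 'q \<Rightarrow> real ^ 'q \<Rightarrow> real \<Rightarrow> real ^ 'n ^ 'n" where
  "elem_mass B xi w J = J *\<^sub>R mass B xi w"

definition stiff :: "('n \<Rightarrow> real poly) \<Rightarrow> real ^ 'q \<Rightarrow> real ^ 'q \<Rightarrow> real ^ 'n ^ 'n" where
  "stiff B xi w = transpose (basis_mat B xi) ** diag w ** dbasis_mat B xi"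

definition diff_pow ::
    "nat \<Rightarrow> ('n \<Rightarrow> real poly) \<Rightarrow> real ^ 'q \<Rightarrow> real ^ 'q \<Rightarrow> real ^ 'n ^ 'n" where
  "diff_pow p B xi w = matpow (matrix_inv (mass B xi w) ** stiff B xi w) p"

definition esfr_corr ::
    "nat \<Rightarrow> real \<Rightarrow> ('n \<Rightarrow> real poly) \<Rightarrow> real ^ 'q \<Rightarrow> real ^ 'q \<Rightarrow> real \<Rightarrow> real ^ 'n ^ 'n" where
  "esfr_corr p c B xi w J =
     c *\<^sub>R (transpose (diff_pow p B xi w) ** elem_mass B xi w J ** diff_pow p B xi w)"

definition esfr_mass ::
    "nat \<Rightarrow> real \<Rightarrow> ('n \<Rightarrow> real poly) \<Rightarrow> real ^ 'q \<Rightarrow> real ^ 'q \<Rightarrow> real \<Rightarrow> real ^ 'n ^ 'n" where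
  "esfr_mass p c B xi w J = elem_mass B xi w J + esfr_corr p c B xi w J"

definition l2_proj ::
    "('n \<Rightarrow> real poly) \<Rightarrow> real ^ 'q \<Rightarrow> real ^ 'q \<Rightarrow> real \<Rightarrow> real ^ 'q ^ 'n" where
  "l2_proj B xi w J =
     J *\<^sub>R (matrix_inv (elem_mass B xi w J) ** transpose (basis_mat B xi) ** diag w)"

definition nodal_vals :: "('n \<Rightarrow> real poly) \<Rightarrow> real ^ 'q \<Rightarrow> real ^ 'n \<Rightarrow> real ^ 'q" where
  "nodal_vals B xi u = basis_mat B xi *v u"

definition modal_flux ::
    "('n \<Rightarrow> real poly) \<Rightarrow> real ^ 'q \<Rightarrow> real ^ 'q \<Rightarrow> real \<Rightarrow> real ^ 'n \<Rightarrow> real ^ 'n" where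
  "modal_flux B xi w J u =
     l2_proj B xi w J *v ((1/2) *\<^sub>R (diag (nodal_vals B xi u) *v nodal_vals B xi u))"

definition face_val :: "('n \<Rightarrow> real poly) \<Rightarrow> face \<Rightarrow> real ^ 'n \<Rightarrow> real" where
  "face_val B f u = basis_at B (face_pt f) \<bullet> u"

definition face_flux :: "('n \<Rightarrow> real poly) \<Rightarrow> face \<Rightarrow> real ^ 'n \<Rightarrow> real" where
  "face_flux B f u = 1/2 * (face_val B f u)\<^sup>2"

text \<open>
  The right-hand side of the split form on one element; \<open>\<alpha>\<close> is the splitting
  parameter and \<open>fs f\<close> the numerical flux at face \<open>f\<close>.
\<close>

definition esfr_rhs ::
    "real \<Rightarrow> nat \<Rightarrow> real \<Rightarrow> ('n \<Rightarrow> real poly) \<Rightarrow> real ^ 'q \<Rightarrow> real ^ 'q \<Rightarrow> real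
      \<Rightarrow> (face \<Rightarrow> real) \<Rightarrow> real ^ 'n \<Rightarrow> real ^ 'n" where
  "esfr_rhs \<alpha> p c B xi w J fs u =
     (let A = matrix_inv (esfr_mass p c B xi w J);
          fh = modal_flux B xi w J u
      in - (\<alpha> *\<^sub>R (A ** stiff B xi w *v fh))
         - (1 - \<alpha>) *\<^sub>R (A ** transpose (basis_mat B xi) ** diag (nodal_vals B xi u)
                         ** diag w ** dbasis_mat B xi *v u)
         - A *v (\<Sum>f\<in>{L, R}.
             (normal f * (fs f - \<alpha> * (basis_at B (face_pt f) \<bullet> fh) - (1 - \<alpha>) * face_flux B f u))
               *\<^sub>R basis_at B (face_pt f)))"

definition sobolev_normsq ::
    "nat \<Rightarrow> real \<Rightarrow> ('n \<Rightarrow> real poly) \<Rightarrow> real ^ 'q \<Rightarrow> real ^ 'q \<Rightarrow> real \<Rightarrow> real ^ 'n \<Rightarrow> real" where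
  "sobolev_normsq p c B xi w J u = u \<bullet> (esfr_mass p c B xi w J *v u)"

text \<open>
  The contribution of face \<open>f\<close> to the energy rate of one element, where \<open>fs\<close> is
  the numerical flux at that face.
\<close>

definition energy_face_term :: "('n \<Rightarrow> real poly) \<Rightarrow> real ^ 'n \<Rightarrow> face \<Rightarrow> real \<Rightarrow> real" where
  "energy_face_term B u f fs =
     - (u \<bullet> ((normal f * (fs - 1/3 * face_flux B f u)) *\<^sub>R basis_at B (face_pt f)))"

text \<open>\<open>v\<close> and \<open>w\<close> are the traces from the left and the right element.\<close>

definition interface_flux :: "real \<Rightarrow> real \<Rightarrow> real \<Rightarrow> real" where
  "interface_flux lam v w = 1/2 * (w\<^sup>2 / 2 + v\<^sup>2 / 2) - lam * (w - v)"

end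

theory Submission
  imports Defs
begin

text \<open>
  Pairing the scheme with the solution in the broken Sobolev inner product cancels the inverse of
  the mass matrix and turns the volume terms into quadrature sums of polynomials.  Let \<open>u\<close> be
  the solution polynomial, \<open>f\<close> the flux polynomial with coefficients \<open>modal_flux\<close>, and \<open>Q\<close> the
  quadrature of \<open>u\<^sup>2 u'\<close>.

  The nonconservative volume term is \<open>Q\<close> itself.  The conservative one is the
  quadrature of \<open>u f'\<close>.  Exactness for degree \<open>2p - 1\<close> permits integration by parts under the
  quadrature (\<open>discrete_integration_by_parts\<close>), which gives the boundary values of \<open>u f\<close> minus the
  quadrature of \<open>u' f\<close>.  Now \<open>f\<close> is the discrete projection of the nodal values of \<open>u\<^sup>2 / 2\<close> and \<open>u'\<close>
  lies in the polynomial space, so \<open>f\<close> may be exchanged for \<open>u\<^sup>2 / 2\<close> here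
  (\<open>modal_flux_projection\<close>): the subtracted term is \<open>Q / 2\<close>.  The two volume terms, weighted by
  \<open>-\<alpha>\<close> and \<open>-(1 - \<alpha>)\<close>, therefore leave \<open>(3 \<alpha> / 2 - 1) Q\<close>, whose factor vanishes exactly for
  \<open>\<alpha> = 2/3\<close>, while the boundary values of \<open>u f\<close> cancel those subtracted in the correction
  term (\<open>energy_balance\<close>).

  At an interface with traces \<open>v\<close> and \<open>w\<close> and numerical flux \<open>f\<^sup>*\<close>, what remains is
  \<open>(w - v) f\<^sup>* - (w\<^sup>3 - v\<^sup>3) / 6\<close>.  The average in \<open>f\<^sup>*\<close> leaves \<open>(w - v)\<^sup>3 / 12\<close>, since
  \<open>(w\<^sup>2 + v\<^sup>2) / 4 - (w\<^sup>2 + w v + v\<^sup>2) / 6 = (w - v)\<^sup>2 / 12\<close>, and the jump penalty contributes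
  \<open>- lam (w - v)\<^sup>2\<close>.
\<close>

section \<open>Matrices and vectors\<close>

lemma diag_mult_vec_nth: "(diag v *v x) $ i = v $ i * x $ i"
  by (simp add: diag_def matrix_vector_mult_def if_distrib if_distribR cong: if_cong)

lemma inner_transpose_mult_vec:
  fixes A :: "real ^ 'n ^ 'm"
  shows "x \<bullet> (transpose A *v y) = (A *v x) \<bullet> y"
  by (metis dot_lmul_matrix inner_commute transpose_matrix_vector)

lemma transpose_diag: "transpose (diag v) = diag v"
  by (simp add: transpose_def diag_def vec_eq_iff)

lemma transpose_add_matrix:
  fixes A :: "real ^ 'n ^ 'm"
  shows "transpose (A + A') = transpose A + transpose A'"
  by (simp add: transpose_def vec_eq_iff)

lemma matrix_inv_mult_vec:
  fixes A :: "real ^ 'n ^ 'n"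
  assumes "invertible A"
  shows "A *v (matrix_inv A *v x) = x"
proof -
  have "A ** matrix_inv A = mat 1"
    using assms unfolding invertible_def matrix_inv_def by (rule someI2_ex) blast
  then show ?thesis
    by (simp add: matrix_vector_mul_assoc)
qed

lemma transpose_esfr_mass: "transpose (esfr_mass p c B xi w J) = esfr_mass p c B xi w J"
  by (simp add: esfr_mass_def esfr_corr_def elem_mass_def mass_def transpose_add_matrix
      transpose_scalar matrix_transpose_mul transpose_diag matrix_mul_assoc)

section \<open>Coefficient vectors as polynomials\<close>

definition expand :: "('n::finite \<Rightarrow> real poly) \<Rightarrow> real ^ 'n \<Rightarrow> real poly" where
  "expand B a = (\<Sum>j\<in>UNIV. smult (a $ j) (B j))"

definition quad :: "real ^ 'q \<Rightarrow> real ^ 'q \<Rightarrow> real poly \<Rightarrow> real" where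
  "quad xi w r = (\<Sum>i\<in>UNIV. w $ i * poly r (xi $ i))"

lemma quad_add: "quad xi w (r + s) = quad xi w r + quad xi w s"
  by (simp add: quad_def sum.distrib algebra_simps)

lemma basis_at_inner: "basis_at B x \<bullet> a = poly (expand B a) x"
  by (simp add: basis_at_def expand_def inner_vec_def poly_sum mult.commute)

lemma inner_basis_at: "a \<bullet> basis_at B x = poly (expand B a) x"
  by (metis basis_at_inner inner_commute)

lemma basis_mat_mult_nth: "(basis_mat B xi *v a) $ i = poly (expand B a) (xi $ i)"
  by (simp add: basis_mat_def expand_def matrix_vector_mult_def poly_sum mult.commute)

lemma pderiv_expand: "pderiv (expand B a) = (\<Sum>j\<in>UNIV. smult (a $ j) (pderiv (B j)))"
  by (simp add: expand_def higher_pderiv_sum[of 1, simplified] pderiv_smult)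

lemma dbasis_mat_mult_nth: "(dbasis_mat B xi *v a) $ i = poly (pderiv (expand B a)) (xi $ i)"
  by (simp add: dbasis_mat_def pderiv_expand matrix_vector_mult_def poly_sum mult.commute)

lemma degree_expand:
  assumes "poly_basis p B"
  shows "degree (expand B a) \<le> p"
  unfolding expand_def using assms
  by (intro degree_sum_le) (auto simp: poly_basis_def intro: order.trans[OF degree_smult_le])

lemma expand_surj:
  assumes "poly_basis p B" and "degree r \<le> p"
  obtains a where "r = expand B a"
  using assms unfolding poly_basis_def expand_def by blast

lemma inner_mass: "a \<bullet> (mass B xi w *v b) = quad xi w (expand B a * expand B b)"
  by (simp only: mass_def matrix_vector_mul_assoc[symmetric] inner_transpose_mult_vec)
    (simp add: inner_vec_def diag_mult_vec_nth basis_mat_mult_nth dbasis_mat_mult_nth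
      nodal_vals_def quad_def mult_ac)

lemma inner_stiff: "a \<bullet> (stiff B xi w *v b) = quad xi w (expand B a * pderiv (expand B b))"
  by (simp only: stiff_def matrix_vector_mul_assoc[symmetric] inner_transpose_mult_vec)
    (simp add: inner_vec_def diag_mult_vec_nth basis_mat_mult_nth dbasis_mat_mult_nth
      nodal_vals_def quad_def mult_ac)

lemma inner_nonconservative:
  "a \<bullet> ((transpose (basis_mat B xi) ** diag (nodal_vals B xi u) ** diag w ** dbasis_mat B xi) *v b)
     = quad xi w (expand B a * expand B u * pderiv (expand B b))"
  by (simp only: matrix_vector_mul_assoc[symmetric] inner_transpose_mult_vec)
    (simp add: inner_vec_def diag_mult_vec_nth basis_mat_mult_nth dbasis_mat_mult_nth
      nodal_vals_def quad_def mult_ac)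

section \<open>Integration by parts and projection under the quadrature\<close>

text \<open>
  The product has degree at most \<open>2p\<close>, so its derivative is within the degree \<open>2p - 1\<close> that the
  quadrature integrates exactly.
\<close>

lemma discrete_integration_by_parts:
  assumes "quadrature_exact d xi w" and "2 * p - 1 \<le> d"
    and "degree r \<le> p" and "degree s \<le> p"
  shows "quad xi w (r * pderiv s) + quad xi w (pderiv r * s)
           = poly (r * s) 1 - poly (r * s) (-1)"
proof -
  have "degree (pderiv (r * s)) \<le> d"
    using assms(2-4) degree_mult_le[of r s] by (simp add: degree_pderiv)
  then have "quad xi w (pderiv (r * s)) = integral {-1..1} (poly (pderiv (r * s)))"
    using assms(1) by (simp add: quadrature_exact_def quad_def)
  also have "(poly (pderiv (r * s)) has_integral poly (r * s) 1 - poly (r * s) (-1)) {-1..1}"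
  proof (rule fundamental_theorem_of_calculus)
    show "(poly (r * s) has_vector_derivative poly (pderiv (r * s)) x) (at x within {-1..1})" for x
      by (rule has_real_derivative_iff_has_vector_derivative[THEN iffD1,
            OF has_field_derivative_at_within[OF poly_DERIV]])
  qed simp
  then have "integral {-1..1} (poly (pderiv (r * s))) = poly (r * s) 1 - poly (r * s) (-1)"
    by (rule integral_unique)
  finally show ?thesis
    by (simp add: pderiv_mult quad_add[symmetric] add.commute mult.commute)
qed

text \<open>
  Left-multiplying the projection by the mass matrix removes its inverse, leaving plain
  quadrature; any test polynomial of degree at most \<open>p\<close> has coefficients to test with.
\<close>

lemma modal_flux_projection:
  assumes "poly_basis p B" and "invertible (mass B xi w)" and "J \<noteq> 0" and "degree r \<le> p"
  shows "quad xi w (r * expand B (modal_flux B xi w J u)) = 1/2 * quad xi w (r * (expand B u)\<^sup>2)"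
proof -
  obtain a where a: "r = expand B a"
    using expand_surj assms(1,4) by blast
  let ?g = "(1/2) *\<^sub>R (diag (nodal_vals B xi u) *v nodal_vals B xi u)"
  let ?b = "transpose (basis_mat B xi) *v (diag w *v ?g)"
  have inv: "invertible (elem_mass B xi w J)"
    unfolding elem_mass_def using assms(3,2) by (rule scalar_invertible)
  have flux: "modal_flux B xi w J u = J *\<^sub>R (matrix_inv (elem_mass B xi w J) *v ?b)"
    by (simp only: modal_flux_def l2_proj_def matrix_vector_mul_assoc[symmetric]
        scaleR_matrix_vector_assoc[symmetric])
  have "J *\<^sub>R (mass B xi w *v modal_flux B xi w J u)
          = elem_mass B xi w J *v modal_flux B xi w J u"
    by (simp add: elem_mass_def scaleR_matrix_vector_assoc)
  also have "\<dots> = J *\<^sub>R ?b"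
    by (simp only: flux matrix_vector_mult_scaleR matrix_inv_mult_vec[OF inv])
  finally have "mass B xi w *v modal_flux B xi w J u = ?b"
    using assms(3) by simp
  then have "quad xi w (r * expand B (modal_flux B xi w J u)) = a \<bullet> ?b"
    by (simp add: a flip: inner_mass)
  also have "\<dots> = 1/2 * quad xi w (r * (expand B u)\<^sup>2)"
    unfolding inner_transpose_mult_vec unfolding inner_vec_def quad_def sum_distrib_left
    by (intro sum.cong refl)
      (simp add: a diag_mult_vec_nth basis_mat_mult_nth nodal_vals_def power2_eq_square)
  finally show ?thesis .
qed

section \<open>Energy balance\<close>

text \<open>
  Pairing with the solution, for an arbitrary splitting parameter: the volume quadrature
  has no sign, so its factor must vanish; this is what selects \<open>\<alpha> = 2/3\<close>.
\<close>

lemma energy_balance: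
  assumes basis: "poly_basis p B"
    and exact: "quadrature_exact d xi w" "2 * p - 1 \<le> d"
    and inv: "invertible (mass B xi w)" "invertible (esfr_mass p c B xi w J)"
    and J: "J \<noteq> 0"
  shows "u \<bullet> (esfr_mass p c B xi w J *v esfr_rhs \<alpha> p c B xi w J fs u)
           = (3/2 * \<alpha> - 1) * quad xi w ((expand B u)\<^sup>2 * pderiv (expand B u))
             - u \<bullet> (\<Sum>f\<in>{L, R}. (normal f * (fs f - (1 - \<alpha>) * face_flux B f u))
                                  *\<^sub>R basis_at B (face_pt f))"
proof -
  let ?E = "esfr_mass p c B xi w J"
  let ?N = "transpose (basis_mat B xi) ** diag (nodal_vals B xi u) ** diag w ** dbasis_mat B xi"
  define fh where "fh = modal_flux B xi w J u"
  define faces where "faces = (\<Sum>f\<in>{L, R}.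
      (normal f * (fs f - \<alpha> * (basis_at B (face_pt f) \<bullet> fh) - (1 - \<alpha>) * face_flux B f u))
        *\<^sub>R basis_at B (face_pt f))"
  let ?u = "expand B u" and ?f = "expand B fh"
  let ?Q = "quad xi w (?u\<^sup>2 * pderiv ?u)"
  have "esfr_rhs \<alpha> p c B xi w J fs u
      = - (\<alpha> *\<^sub>R (matrix_inv ?E *v (stiff B xi w *v fh)))
        - (1 - \<alpha>) *\<^sub>R (matrix_inv ?E *v (?N *v u)) - matrix_inv ?E *v faces"
    by (simp add: esfr_rhs_def Let_def fh_def faces_def matrix_vector_mul_assoc matrix_mul_assoc)
  then have "?E *v esfr_rhs \<alpha> p c B xi w J fs u
      = - (\<alpha> *\<^sub>R (stiff B xi w *v fh)) - (1 - \<alpha>) *\<^sub>R (?N *v u) - faces"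
    by (simp only: matrix_vector_mult_diff_distrib matrix_vector_mult_scaleR
        scaleR_minus_left[symmetric] matrix_inv_mult_vec[OF inv(2)])
  then have paired: "u \<bullet> (?E *v esfr_rhs \<alpha> p c B xi w J fs u)
      = - \<alpha> * quad xi w (?u * pderiv ?f) - (1 - \<alpha>) * ?Q - u \<bullet> faces"
    by (simp add: inner_diff_right inner_stiff inner_nonconservative power2_eq_square)
  have "quad xi w (pderiv ?u * ?f) = 1/2 * ?Q"
    using modal_flux_projection[OF basis inv(1) J, of "pderiv ?u" u] degree_expand[OF basis, of u]
    by (simp add: fh_def degree_pderiv mult.commute)
  then have conservative:
      "quad xi w (?u * pderiv ?f) = poly (?u * ?f) 1 - poly (?u * ?f) (-1) - 1/2 * ?Q"
    using discrete_integration_by_parts[OF exact degree_expand[OF basis] degree_expand[OF basis],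
        of u fh]
    by linarith
  have boundary: "u \<bullet> faces = u \<bullet> (\<Sum>f\<in>{L, R}. (normal f * (fs f - (1 - \<alpha>) * face_flux B f u))
                                  *\<^sub>R basis_at B (face_pt f))
          - \<alpha> * (poly (?u * ?f) 1 - poly (?u * ?f) (-1))"
    by (simp add: faces_def inner_add_right inner_basis_at basis_at_inner, simp add: algebra_simps)
  have "- \<alpha> * (b - 1/2 * q) - (1 - \<alpha>) * q - (s - \<alpha> * b) = (3/2 * \<alpha> - 1) * q - s"
    for b q s :: real
    by (simp add: algebra_simps)
  then show ?thesis
    unfolding paired conservative boundary .
qed

text \<open>Symmetry of the mass matrix turns the two product-rule terms into the same pairing.\<close>

lemma sobolev_normsq_has_real_derivative:
  fixes u :: "real \<Rightarrow> real ^ 'n::finite"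
  assumes "(u has_vector_derivative u') (at t within T)"
  shows "((\<lambda>s. 1/2 * sobolev_normsq p c B xi w J (u s)) has_real_derivative
            u t \<bullet> (esfr_mass p c B xi w J *v u')) (at t within T)"
proof -
  let ?E = "esfr_mass p c B xi w J"
  have "((\<lambda>s. u s \<bullet> (?E *v u s)) has_vector_derivative u t \<bullet> (?E *v u') + u' \<bullet> (?E *v u t))
          (at t within T)"
    by (intro bounded_bilinear.has_vector_derivative[OF bounded_bilinear_inner] assms
        bounded_linear.has_vector_derivative[OF matrix_vector_mul_bounded_linear])
  moreover have "u' \<bullet> (?E *v u t) = u t \<bullet> (?E *v u')"
    using inner_transpose_mult_vec[of u' ?E "u t"] by (simp add: transpose_esfr_mass inner_commute)
  ultimately have "((\<lambda>s. u s \<bullet> (?E *v u s)) has_real_derivative 2 * (u t \<bullet> (?E *v u')))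
          (at t within T)"
    by (simp add: has_real_derivative_iff_has_vector_derivative)
  from DERIV_cmult[OF this, of "1/2"] show ?thesis
    by (simp add: sobolev_normsq_def)
qed

section \<open>Interface terms\<close>

lemma interface_energy:
  assumes "v = face_val B R ua" and "w = face_val B L ub"
  shows "energy_face_term B ua R (interface_flux lam v w)
           + energy_face_term B ub L (interface_flux lam v w)
         = (w - v)\<^sup>2 * (1/12 * (w - v) - lam)"
  by (simp add: assms energy_face_term_def face_flux_def face_val_def interface_flux_def
      inner_basis_at basis_at_inner, simp add: field_simps power2_eq_square)

lemma interface_energy_nonpos:
  fixes v w lam :: real
  assumes "lam \<ge> 1/12 * (w - v)"
  shows "(w - v)\<^sup>2 * (1/12 * (w - v) - lam) \<le> 0"
  using assms by (intro mult_nonneg_nonpos) simp_all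

lemma lax_friedrichs_bound:
  fixes v w :: real
  shows "1/2 * max \<bar>w\<bar> \<bar>v\<bar> \<ge> 1/12 * (w - v)"
  by (auto simp: max_def abs_if)

theorem mainTheorem2:
  fixes p d :: nat
    and B :: "'n::finite \<Rightarrow> real poly"
    and xi w :: "real ^ 'q::finite"
    and c :: real
    and J :: "'e \<Rightarrow> real"
    and interfaces :: "('e \<times> 'e) set"  \<comment> \<open>\<open>(a, b)\<close>: face \<open>R\<close> of \<open>a\<close> is face \<open>L\<close> of \<open>b\<close>\<close>
    and T :: "real set"
    and u :: "'e \<Rightarrow> real \<Rightarrow> real ^ 'n"
    and fstar :: "'e \<Rightarrow> face \<Rightarrow> real \<Rightarrow> real"
  assumes "p \<ge> 1"
    and "CARD('n) = p + 1"
    and "poly_basis p B"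
    and "\<And>i. xi $ i \<in> {-1..1}"
    and "d \<ge> 2 * p - 1"
    and "quadrature_exact d xi w"
    and "\<And>m. J m > 0"
    and "invertible (mass B xi w)"
    and "\<And>m. invertible (esfr_mass p c B xi w (J m))"
    and "\<And>m t. t \<in> T \<Longrightarrow>
           (u m has_vector_derivative
              esfr_rhs (2/3) p c B xi w (J m) (\<lambda>f. fstar m f t) (u m t)) (at t within T)"
  shows
    "(\<forall>m. \<forall>t\<in>T.
        ((\<lambda>s. 1/2 * sobolev_normsq p c B xi w (J m) (u m s)) has_real_derivative
           - (u m t \<bullet> (\<Sum>f\<in>{L, R}.
                (normal f * (fstar m f t - 1/3 * face_flux B f (u m t)))
                  *\<^sub>R basis_at B (face_pt f)))) (at t within T))
     \<and>
     (\<forall>(a, b)\<in>interfaces. \<forall>t\<in>T. \<forall>lam vp w0.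
        vp = face_val B R (u a t) \<longrightarrow>
        w0 = face_val B L (u b t) \<longrightarrow>
        fstar a R t = interface_flux lam vp w0 \<longrightarrow>
        fstar b L t = interface_flux lam vp w0 \<longrightarrow>
          energy_face_term B (u a t) R (fstar a R t) + energy_face_term B (u b t) L (fstar b L t)
            = (w0 - vp)\<^sup>2 * (1/12 * (w0 - vp) - lam)
        \<and> (lam \<ge> 1/12 * (w0 - vp) \<longrightarrow>
             energy_face_term B (u a t) R (fstar a R t)
               + energy_face_term B (u b t) L (fstar b L t) \<le> 0)
        \<and> (lam = 1/2 * max \<bar>w0\<bar> \<bar>vp\<bar> \<longrightarrow>
             energy_face_term B (u a t) R (fstar a R t)
               + energy_face_term B (u b t) L (fstar b L t) \<le> 0))
     \<and>
     (\<forall>w0 vp :: real. 1/2 * max \<bar>w0\<bar> \<bar>vp\<bar> \<ge> 1/12 * (w0 - vp))"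
proof (intro conjI allI ballI, goal_cases)
  case (1 m t)
  have "J m \<noteq> 0"
    using assms(7)[of m] by simp
  then have balance: "u m t \<bullet> (esfr_mass p c B xi w (J m) *v
          esfr_rhs (2/3) p c B xi w (J m) (\<lambda>f. fstar m f t) (u m t))
      = - (u m t \<bullet> (\<Sum>f\<in>{L, R}. (normal f * (fstar m f t - 1/3 * face_flux B f (u m t)))
                                  *\<^sub>R basis_at B (face_pt f)))"
    using energy_balance[OF assms(3,6,5,8) assms(9)[of m],
        of "u m t" "2/3" "\<lambda>f. fstar m f t"] by simp
  show ?case
    by (rule DERIV_cong[OF sobolev_normsq_has_real_derivative[OF assms(10)[OF 1]] balance])
next
  case (2 ab)
  show ?case
  proof (cases ab)
    case (Pair a b)
    show ?thesis
      unfolding Pair prod.case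
    proof (intro ballI allI impI)
      fix t lam vp w0
      assume traces: "vp = face_val B R (u a t)" "w0 = face_val B L (u b t)"
        and flux: "fstar a R t = interface_flux lam vp w0" "fstar b L t = interface_flux lam vp w0"
      let ?contribution = "energy_face_term B (u a t) R (fstar a R t)
                             + energy_face_term B (u b t) L (fstar b L t)"
      have energy: "?contribution = (w0 - vp)\<^sup>2 * (1/12 * (w0 - vp) - lam)"
        unfolding flux using traces by (rule interface_energy)
      have nonpos: "?contribution \<le> 0" if "lam \<ge> 1/12 * (w0 - vp)"
        unfolding energy using that by (rule interface_energy_nonpos)
      have "?contribution \<le> 0" if "lam = 1/2 * max \<bar>w0\<bar> \<bar>vp\<bar>"
        using nonpos lax_friedrichs_bound unfolding that by blast
      with energy nonpos show "?contribution = (w0 - vp)\<^sup>2 * (1/12 * (w0 - vp) - lam)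
          \<and> (lam \<ge> 1/12 * (w0 - vp) \<longrightarrow> ?contribution \<le> 0)
          \<and> (lam = 1/2 * max \<bar>w0\<bar> \<bar>vp\<bar> \<longrightarrow> ?contribution \<le> 0)"
        by blast
    qed
  qed
next
  case (3 w0 vp)
  show ?case
    by (rule lax_friedrichs_bound)
qed

end
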